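(* Let $X$ be a normed linear space and $Y$ a Banach space. Let $\alpha,\beta$ be real numbers, and let $f_1,f_2: X\times X\to X\times X$ and $\mu: X\times X\to[0,\infty)$ be arbitrary given mappings. For $\delta: X\times X\to[0,\infty)$ define $\Lambda\delta: X\times X\to[0,\infty)$ by $$(\Lambda\delta)(x,y):=|\alpha|\,\delta(f_1(x,y))+|\beta|\,\delta(f_2(x,y)),\qquad (x,y)\in X\times X,$$ and suppose that $$\mu^*(x,y):=\sum_{n=0}^\infty(\Lambda^n\mu)(x,y)<\infty\qquad\text{for all }(x,y)\in X\times X.$$ Let $f: X\times X\to Y$ be a mapping satisfying $$\|f(x,y)-\alpha f(f_1(x,y))-\beta f(f_2(x,y))\|\le\mu(x,y)\qquad\text{for all }(x,y)\in X\times X.$$ Then there exists a unique mapping $K: X\times X\to Y$ such that $$K(x,y)=\alpha K(f_1(x,y))+\beta K(f_2(x,y))\qquad\text{for all }(x,y)\in X\times X$$ and $$\|f(x,y)-K(x,y)\|\le\mu^*(x,y)\qquad\text{for all }(x,y)\in X\times X.$$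
   Context: $\Lambda^n$ denotes the $n$-fold iterate of the operator $\Lambda$, with $\Lambda^0$ the identity, so that $\Lambda^0\mu=\mu$. *)

theory Defs
  imports Complex_Main
begin

text \<open>The operator maps nonnegative functions to nonnegative functions, so it is defined on
  all real-valued functions and nonnegativity is kept as a hypothesis where it is needed.\<close>

definition Lambda ::
  "real \<Rightarrow> real \<Rightarrow> ('a \<times> 'a \<Rightarrow> 'a \<times> 'a) \<Rightarrow> ('a \<times> 'a \<Rightarrow> 'a \<times> 'a)
    \<Rightarrow> ('a \<times> 'a \<Rightarrow> real) \<Rightarrow> ('a \<times> 'a \<Rightarrow> real)"
  where "Lambda \<alpha> \<beta> f1 f2 \<delta> = (\<lambda>(x, y). \<bar>\<alpha>\<bar> * \<delta> (f1 (x, y)) + \<bar>\<beta>\<bar> * \<delta> (f2 (x, y)))"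

text \<open>The sum is taken in the reals; it has its intended value where the series is summable,
  which for nonnegative terms means exactly that it is finite.\<close>

definition mu_star ::
  "real \<Rightarrow> real \<Rightarrow> ('a \<times> 'a \<Rightarrow> 'a \<times> 'a) \<Rightarrow> ('a \<times> 'a \<Rightarrow> 'a \<times> 'a)
    \<Rightarrow> ('a \<times> 'a \<Rightarrow> real) \<Rightarrow> ('a \<times> 'a \<Rightarrow> real)"
  where "mu_star \<alpha> \<beta> f1 f2 \<mu> = (\<lambda>(x, y). \<Sum>n. (Lambda \<alpha> \<beta> f1 f2 ^^ n) \<mu> (x, y))"

end

theory Submission
  imports Defs
begin

text \<open>Let $T g = \alpha\, g \circ f_1 + \beta\, g \circ f_2$. If $\delta$ dominates the norm
  of $g$, then $\Lambda^n \delta$ dominates the norm of $T^n g$. Hence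
  $\|T^n f - T^{n+1} f\| \le \Lambda^n \mu$, so $T^n f$ converges to a fixed point of $T$ within
  distance $\mu^*$ of $f$. Conversely, a fixed point $K$ within distance $\mu^*$ of $f$ satisfies
  $\|T^n f - K\| = \|T^n (f - K)\| \le \Lambda^n \mu^* = \sum_{k \ge n} \Lambda^k \mu \to 0$.\<close>

text \<open>This is the operator T; \<open>Lambda\<close> is its counterpart on real functions, with
  the absolute values of the coefficients.\<close>

definition weighted_comp ::
  "real \<Rightarrow> real \<Rightarrow> ('c \<Rightarrow> 'c) \<Rightarrow> ('c \<Rightarrow> 'c) \<Rightarrow> ('c \<Rightarrow> 'b) \<Rightarrow> 'c \<Rightarrow> 'b::real_normed_vector"
  where "weighted_comp \<alpha> \<beta> f1 f2 g p = \<alpha> *\<^sub>R g (f1 p) + \<beta> *\<^sub>R g (f2 p)"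

lemma weighted_comp_funpow_diff:
  "(weighted_comp \<alpha> \<beta> f1 f2 ^^ n) (\<lambda>p. g p - h p)
    = (\<lambda>p. (weighted_comp \<alpha> \<beta> f1 f2 ^^ n) g p - (weighted_comp \<alpha> \<beta> f1 f2 ^^ n) h p)"
  by (induction n) (auto simp: weighted_comp_def algebra_simps)

lemma Lambda_apply: "Lambda \<alpha> \<beta> f1 f2 \<delta> p = \<bar>\<alpha>\<bar> * \<delta> (f1 p) + \<bar>\<beta>\<bar> * \<delta> (f2 p)"
  by (cases p) (simp add: Lambda_def)

lemma mu_star_apply: "mu_star \<alpha> \<beta> f1 f2 \<mu> p = (\<Sum>n. (Lambda \<alpha> \<beta> f1 f2 ^^ n) \<mu> p)"
  by (cases p) (simp add: mu_star_def)

text \<open>Each step is the triangle inequality followed by monotonicity of \<open>Lambda\<close>,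
  whose coefficients are nonnegative. It serves twice: for f - K dominated by
  \<open>mu_star\<close>, and for f - T f dominated by \<open>\<mu>\<close>.\<close>

lemma norm_weighted_comp_funpow_le:
  assumes "\<And>p. norm (g p) \<le> \<delta> p"
  shows "norm ((weighted_comp \<alpha> \<beta> f1 f2 ^^ n) g p) \<le> (Lambda \<alpha> \<beta> f1 f2 ^^ n) \<delta> p"
proof (induction n arbitrary: p)
  case 0
  then show ?case using assms by simp
next
  case (Suc n)
  let ?g = "(weighted_comp \<alpha> \<beta> f1 f2 ^^ n) g"
  have "norm (\<alpha> *\<^sub>R ?g (f1 p) + \<beta> *\<^sub>R ?g (f2 p))
      \<le> \<bar>\<alpha>\<bar> * norm (?g (f1 p)) + \<bar>\<beta>\<bar> * norm (?g (f2 p))"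
    by (rule norm_triangle_le) simp
  also have "\<dots> \<le> Lambda \<alpha> \<beta> f1 f2 ((Lambda \<alpha> \<beta> f1 f2 ^^ n) \<delta>) p"
    unfolding Lambda_apply[of _ _ _ _ _ p] by (intro add_mono mult_left_mono Suc.IH) auto
  finally show ?case by (simp add: weighted_comp_def[of _ _ _ _ _ p])
qed

text \<open>At each point \<open>Lambda\<close> is a linear combination of two values, so it passes
  through a convergent series and raises every exponent by one. What remains is a tail of the series
  for \<open>mu_star\<close>.\<close>

lemma Lambda_funpow_mu_star:
  assumes "\<And>p. summable (\<lambda>n. (Lambda \<alpha> \<beta> f1 f2 ^^ n) \<mu> p)"
  shows "(Lambda \<alpha> \<beta> f1 f2 ^^ n) (mu_star \<alpha> \<beta> f1 f2 \<mu>) p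
    = (\<Sum>k. (Lambda \<alpha> \<beta> f1 f2 ^^ (k + n)) \<mu> p)"
proof (induction n arbitrary: p)
  case 0
  then show ?case by (simp add: mu_star_apply)
next
  case (Suc n)
  have sm: "summable (\<lambda>k. (Lambda \<alpha> \<beta> f1 f2 ^^ (k + n)) \<mu> q)" for q
    using assms by (rule summable_ignore_initial_segment)
  have "(Lambda \<alpha> \<beta> f1 f2 ^^ Suc n) (mu_star \<alpha> \<beta> f1 f2 \<mu>) p
      = \<bar>\<alpha>\<bar> * (\<Sum>k. (Lambda \<alpha> \<beta> f1 f2 ^^ (k + n)) \<mu> (f1 p))
        + \<bar>\<beta>\<bar> * (\<Sum>k. (Lambda \<alpha> \<beta> f1 f2 ^^ (k + n)) \<mu> (f2 p))"
    by (simp add: Lambda_apply[of _ _ _ _ _ p] Suc.IH)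
  also have "\<dots> = (\<Sum>k. \<bar>\<alpha>\<bar> * (Lambda \<alpha> \<beta> f1 f2 ^^ (k + n)) \<mu> (f1 p)
        + \<bar>\<beta>\<bar> * (Lambda \<alpha> \<beta> f1 f2 ^^ (k + n)) \<mu> (f2 p))"
    by (simp add: suminf_mult[symmetric] suminf_add summable_mult sm)
  finally show ?case by (simp add: Lambda_apply[of _ _ _ _ _ p])
qed

text \<open>This yields uniqueness: the sequence depends on \<open>f\<close> alone, so two such
  fixed points are limits of the same sequence.\<close>

lemma weighted_comp_fixpoint_limit:
  fixes f K :: "'a \<times> 'a \<Rightarrow> 'b::real_normed_vector"
  assumes sm: "\<And>p. summable (\<lambda>n. (Lambda \<alpha> \<beta> f1 f2 ^^ n) \<mu> p)"
    and fixpoint: "weighted_comp \<alpha> \<beta> f1 f2 K = K"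
    and near: "\<And>p. norm (f p - K p) \<le> mu_star \<alpha> \<beta> f1 f2 \<mu> p"
  shows "(\<lambda>n. (weighted_comp \<alpha> \<beta> f1 f2 ^^ n) f p) \<longlonglongrightarrow> K p"
proof -
  have K: "(weighted_comp \<alpha> \<beta> f1 f2 ^^ n) K = K" for n
    by (induction n) (auto simp: fixpoint)
  have le: "norm ((weighted_comp \<alpha> \<beta> f1 f2 ^^ n) f p - K p)
      \<le> (\<Sum>k. (Lambda \<alpha> \<beta> f1 f2 ^^ (k + n)) \<mu> p)" for n
    using norm_weighted_comp_funpow_le[of "\<lambda>p. f p - K p", OF near,
        where \<alpha>=\<alpha> and \<beta>=\<beta> and ?f1.0=f1 and ?f2.0=f2 and n=n and p=p]
    by (simp add: weighted_comp_funpow_diff K Lambda_funpow_mu_star[OF sm])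
  \<comment> \<open>The tail is the full sum minus the first \<open>n\<close> terms, and these
    partial sums tend to the full sum.\<close>
  have tail: "(\<lambda>n. \<Sum>k. (Lambda \<alpha> \<beta> f1 f2 ^^ (k + n)) \<mu> p) \<longlonglongrightarrow> 0"
    using tendsto_diff[OF tendsto_const summable_LIMSEQ[OF sm[of p]],
        of "\<Sum>k. (Lambda \<alpha> \<beta> f1 f2 ^^ k) \<mu> p"]
    by (simp add: suminf_minus_initial_segment[OF sm])
  have "(\<lambda>n. norm ((weighted_comp \<alpha> \<beta> f1 f2 ^^ n) f p - K p)) \<longlonglongrightarrow> 0"
    by (rule tendsto_sandwich[OF _ _ tendsto_const tail]) (simp_all add: le)
  then show ?thesis by (simp add: tendsto_norm_zero_iff LIM_zero_iff)
qed

text \<open>The differences of successive iterates are dominated by a convergent series, so they are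
  summable by completeness of the target space.\<close>

lemma weighted_comp_fixpoint_exists:
  fixes f :: "'a \<times> 'a \<Rightarrow> 'b::banach"
  assumes sm: "\<And>p. summable (\<lambda>n. (Lambda \<alpha> \<beta> f1 f2 ^^ n) \<mu> p)"
    and approx: "\<And>p. norm (f p - weighted_comp \<alpha> \<beta> f1 f2 f p) \<le> \<mu> p"
  obtains K where "weighted_comp \<alpha> \<beta> f1 f2 K = K"
    and "\<And>p. norm (f p - K p) \<le> mu_star \<alpha> \<beta> f1 f2 \<mu> p"
proof -
  define F where "F n = (weighted_comp \<alpha> \<beta> f1 f2 ^^ n) f" for n
  define D where "D p n = F n p - F (Suc n) p" for p n
  \<comment> \<open>By linearity T^n (f - T f) at \<open>p\<close> is \<open>D p n\<close>, since
    T^n (T f) is \<open>F (Suc n)\<close>.\<close>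
  have D_le: "norm (D p n) \<le> (Lambda \<alpha> \<beta> f1 f2 ^^ n) \<mu> p" for p n
    using norm_weighted_comp_funpow_le[of "\<lambda>p. f p - weighted_comp \<alpha> \<beta> f1 f2 f p", OF approx,
        where \<alpha>=\<alpha> and \<beta>=\<beta> and ?f1.0=f1 and ?f2.0=f2 and n=n and p=p]
    by (simp add: weighted_comp_funpow_diff D_def F_def funpow_swap1)
  have smD: "summable (D p)" and normD: "norm (suminf (D p)) \<le> mu_star \<alpha> \<beta> f1 f2 \<mu> p" for p
    using summable_comparison_test'[OF sm D_le] norm_suminf_le[OF D_le sm]
    by (simp_all add: mu_star_apply)
  \<comment> \<open>By telescoping this is the limit of \<open>F n p\<close>. In this form f - K is
    the sum of the differences, whose norm \<open>normD\<close> already bounds.\<close>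
  define K where "K p = f p - suminf (D p)" for p
  have F_sum: "F n p = f p - sum (D p) {..<n}" for n p
    by (induction n) (auto simp: D_def F_def)
  have lim: "(\<lambda>n. F n p) \<longlonglongrightarrow> K p" for p
    unfolding F_sum K_def by (intro tendsto_intros summable_LIMSEQ smD)
  have "weighted_comp \<alpha> \<beta> f1 f2 K = K"
  \<comment> \<open>The shifted sequence has the same limit \<open>K p\<close>; passing to the limit
    inside T gives the other value.\<close>
  proof (rule ext, rule LIMSEQ_unique)
    fix p
    show "(\<lambda>n. F (Suc n) p) \<longlonglongrightarrow> K p"
      using lim by (rule LIMSEQ_Suc)
    have "F (Suc n) p = \<alpha> *\<^sub>R F n (f1 p) + \<beta> *\<^sub>R F n (f2 p)" for n
      by (simp add: F_def weighted_comp_def[of _ _ _ _ _ p])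
    then show "(\<lambda>n. F (Suc n) p) \<longlonglongrightarrow> weighted_comp \<alpha> \<beta> f1 f2 K p"
      unfolding weighted_comp_def by (auto intro!: tendsto_intros lim)
  qed
  then show thesis
    using that[of K] normD by (simp add: K_def)
qed

theorem theorem2p1:
  fixes \<alpha> \<beta> :: real
    and f1 f2 :: "'a::real_normed_vector \<times> 'a \<Rightarrow> 'a \<times> 'a"
    and \<mu> :: "'a \<times> 'a \<Rightarrow> real"
    and f :: "'a \<times> 'a \<Rightarrow> 'b::banach"
  assumes "\<And>x y. 0 \<le> \<mu> (x, y)"
    and "\<And>x y. summable (\<lambda>n. (Lambda \<alpha> \<beta> f1 f2 ^^ n) \<mu> (x, y))"
    and "\<And>x y. norm (f (x, y) - \<alpha> *\<^sub>R f (f1 (x, y)) - \<beta> *\<^sub>R f (f2 (x, y))) \<le> \<mu> (x, y)"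
  shows "\<exists>!K :: 'a \<times> 'a \<Rightarrow> 'b.
    (\<forall>x y. K (x, y) = \<alpha> *\<^sub>R K (f1 (x, y)) + \<beta> *\<^sub>R K (f2 (x, y))) \<and>
    (\<forall>x y. norm (f (x, y) - K (x, y)) \<le> mu_star \<alpha> \<beta> f1 f2 \<mu> (x, y))"
    (is "\<exists>!K. ?P K")
proof -
  \<comment> \<open>Both conditions are restated for points \<open>p\<close> instead of coordinates,
    with the functional equation as a fixed-point equation.\<close>
  have P_iff: "?P K \<longleftrightarrow> weighted_comp \<alpha> \<beta> f1 f2 K = K
      \<and> (\<forall>p. norm (f p - K p) \<le> mu_star \<alpha> \<beta> f1 f2 \<mu> p)" for K
    by (auto simp: weighted_comp_def fun_eq_iff)
  have sm: "summable (\<lambda>n. (Lambda \<alpha> \<beta> f1 f2 ^^ n) \<mu> p)" for p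
    using assms(2) by (cases p) simp
  have approx: "norm (f p - weighted_comp \<alpha> \<beta> f1 f2 f p) \<le> \<mu> p" for p
    using assms(3) by (cases p) (simp add: weighted_comp_def diff_diff_eq)
  obtain K where K: "weighted_comp \<alpha> \<beta> f1 f2 K = K"
      "\<And>p. norm (f p - K p) \<le> mu_star \<alpha> \<beta> f1 f2 \<mu> p"
    using weighted_comp_fixpoint_exists[OF sm approx] by blast
  show ?thesis
  proof (rule ex1I)
    show "?P K"
      unfolding P_iff using K by blast
    fix K' assume "?P K'"
    then have K': "weighted_comp \<alpha> \<beta> f1 f2 K' = K'"
        "\<And>p. norm (f p - K' p) \<le> mu_star \<alpha> \<beta> f1 f2 \<mu> p"
      unfolding P_iff by blast+
    show "K' = K"
      using weighted_comp_fixpoint_limit[OF sm K'] weighted_comp_fixpoint_limit[OF sm K]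
      by (blast intro: LIMSEQ_unique)
  qed
qed

end
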